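(* Let $d=O(1)$ and let $\mathbf G$ be a uniformly random $d$-regular graph on nodes $[n]$ (with $dn$ even), with $s=1$, $t=n$. Then any (possibly randomized) algorithm that outputs an $s$-$t$ path in $\mathbf G$ using node-incidence queries either makes $\Omega(\sqrt n)$ node-incidence queries, or outputs a valid $s$-$t$ path with probability at most $o(1)$.
   Context: Query model: the nodes are labeled by $[n]$; a node-incidence query specifies a node $i\in[n]$ and returns the set of all edges incident to $i$. The algorithm chooses each query (possibly randomly) as a function of the answers to previous queries, and finally outputs a sequence of nodes from $s$ to $t$; the output is valid if every consecutive pair is an edge of the graph. *)

theory Defs
  imports "HOL-Probability.Probability"
begin

text \<open>A simple graph on the nodes \<open>{1..n}\<close> is given by its set of two-element edges.\<close>

type_synonym edge = "nat set"

definition incident :: "edge set \<Rightarrow> nat \<Rightarrow> edge set" where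
  "incident E v = {e \<in> E. v \<in> e}"

definition regular_graphs :: "nat \<Rightarrow> nat \<Rightarrow> edge set set" where
  "regular_graphs n d =
     {E. E \<subseteq> {e. e \<subseteq> {1..n} \<and> card e = 2} \<and> (\<forall>v\<in>{1..n}. card (incident E v) = d)}"

definition valid_path :: "edge set \<Rightarrow> nat \<Rightarrow> nat \<Rightarrow> nat list \<Rightarrow> bool" where
  "valid_path E s t p \<longleftrightarrow>
     p \<noteq> [] \<and> hd p = s \<and> last p = t \<and> successively (\<lambda>u v. {u, v} \<in> E) p"

text \<open>
  A randomized algorithm maps the history of queries and answers (oldest first) to a
  distribution over its next action. Distributions with countable support lose no
  generality, because the type of actions is countable.
  A query outside \<open>{1..n}\<close> is counted but has the empty answer.
\<close>

datatype action = Query nat | Output "nat list"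

type_synonym history = "(nat \<times> edge set) list"
type_synonym algorithm = "history \<Rightarrow> action pmf"

text \<open>
  The distribution of the final output on the graph \<open>E\<close>, continuing from a history.
  The missing mass of the subprobability distribution is the probability of never halting.
\<close>

partial_function (spmf) run :: "algorithm \<Rightarrow> edge set \<Rightarrow> history \<Rightarrow> nat list spmf" where
  "run A E h = bind_spmf (spmf_of_pmf (A h))
     (\<lambda>a. case a of
            Query v \<Rightarrow> run A E (h @ [(v, incident E v)])
          | Output p \<Rightarrow> return_spmf p)"

text \<open>Histories that occur with positive probability when the algorithm is run on \<open>E\<close>:\<close>

inductive reachable :: "algorithm \<Rightarrow> edge set \<Rightarrow> history \<Rightarrow> bool"
  for A :: algorithm and E :: "edge set" where
  start: "reachable A E []"
| query: "reachable A E h \<Longrightarrow> Query v \<in> set_pmf (A h) \<Longrightarrow> reachable A E (h @ [(v, incident E v)])"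

text \<open>
  Worst-case number of queries, over the possible inputs and the internal randomness;
  an algorithm with unbounded runs makes at least \<open>r\<close> queries for every \<open>r\<close>.
\<close>

definition makes_at_least_queries :: "nat \<Rightarrow> nat \<Rightarrow> algorithm \<Rightarrow> real \<Rightarrow> bool" where
  "makes_at_least_queries n d A r \<longleftrightarrow>
     (\<exists>E\<in>regular_graphs n d. \<exists>h. reachable A E h \<and> real (length h) \<ge> r)"

text \<open>
  The probability is over both the uniformly random graph and the internal randomness.
  It is meaningful only when \<open>regular_graphs n d\<close> is nonempty.
\<close>

definition success_prob :: "nat \<Rightarrow> nat \<Rightarrow> nat \<Rightarrow> nat \<Rightarrow> algorithm \<Rightarrow> real" where
  "success_prob n d s t A =
     measure_pmf.prob
       (bind_pmf (pmf_of_set (regular_graphs n d))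
          (\<lambda>E. map_pmf (\<lambda>out. (E, out)) (run A E [])))
       {(E, Some p) | E p. valid_path E s t p}"

end

theory Submission
  imports Defs
begin

text \<open>
  Condition the uniform random graph on the answers of at most \<open>k\<close> queries. An edge \<open>{u, w}\<close>
  that is not among the answers is present with probability at most \<open>2d/n\<close>: replacing the edges
  \<open>{u, w}\<close> and \<open>{x, y}\<close> by \<open>{u, x}\<close> and \<open>{w, y}\<close> can be done in at least \<open>dn/2\<close> ways, but a
  graph arises in at most \<open>d\<^sup>2\<close> ways. Hence a query attaches a new edge to one of the \<open>O(k)\<close> nodes
  seen so far with probability \<open>O(k/n)\<close>. Without such a collision the known edges never connect
  \<open>s\<close> with \<open>t\<close>, and then a valid output path must contain an unknown edge determined by the
  history, which is present with probability \<open>O(1/n)\<close>. Altogether the success probability is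
  \<open>O((1 + k\<^sup>2)/n)\<close>.
\<close>

section \<open>Switchings in regular graphs\<close>

definition neighbours :: "edge set \<Rightarrow> nat \<Rightarrow> nat set" where
  "neighbours E v = {y. {v, y} \<in> E}"

lemma regular_graphs_edgeD:
  assumes "E \<in> regular_graphs n d" "{x, y} \<in> E"
  shows "x \<in> {1..n}" "y \<in> {1..n}" "x \<noteq> y"
proof -
  have *: "{x, y} \<subseteq> {1..n}" "card {x, y} = 2"
    using assms by (auto simp: regular_graphs_def)
  then show "x \<in> {1..n}" "y \<in> {1..n}" by auto
  show "x \<noteq> y" using *(2) by auto
qed

lemma finite_regular_graph: "E \<in> regular_graphs n d \<Longrightarrow> finite E"
  by (rule finite_subset[of _ "Pow {1..n}"]) (auto simp: regular_graphs_def)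

lemma finite_regular_graphs: "finite (regular_graphs n d)"
  by (rule finite_subset[of _ "Pow (Pow {1..n})"]) (auto simp: regular_graphs_def)

lemma neighbours_subset: "E \<in> regular_graphs n d \<Longrightarrow> neighbours E v \<subseteq> {1..n}"
  using regular_graphs_edgeD(2) by (auto simp: neighbours_def)

lemma finite_neighbours: "E \<in> regular_graphs n d \<Longrightarrow> finite (neighbours E v)"
  by (rule finite_subset[OF neighbours_subset]) auto

lemma incident_eq_image_neighbours:
  assumes "\<And>e. e \<in> E \<Longrightarrow> card e = 2"
  shows "incident E v = (\<lambda>y. {v, y}) ` neighbours E v"
proof (intro equalityI subsetI)
  fix e assume "e \<in> incident E v"
  then have e: "e \<in> E" "v \<in> e" by (auto simp: incident_def)
  then have "card e = 2" using assms by blast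
  then obtain x y where "e = {x, y}" by (auto simp: card_2_iff)
  then show "e \<in> (\<lambda>y. {v, y}) ` neighbours E v"
    using e by (auto simp: neighbours_def insert_commute)
qed (auto simp: incident_def neighbours_def)

lemma card_incident:
  assumes "\<And>e. e \<in> E \<Longrightarrow> card e = 2"
  shows "card (incident E v) = card (neighbours E v)"
proof -
  have "inj_on (\<lambda>y. {v, y}) (neighbours E v)"
    by (auto simp: inj_on_def doubleton_eq_iff)
  then show ?thesis
    using incident_eq_image_neighbours[OF assms] by (simp add: card_image)
qed

lemma card_neighbours:
  assumes "E \<in> regular_graphs n d" "v \<in> {1..n}"
  shows "card (neighbours E v) = d"
  using card_incident[of E v] assms by (auto simp: regular_graphs_def)

lemma card_neighbours_le:
  assumes "E \<in> regular_graphs n d"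
  shows "card (neighbours E v) \<le> d"
proof (cases "v \<in> {1..n}")
  case False
  then have "neighbours E v = {}"
    using regular_graphs_edgeD(1)[OF assms] by (auto simp: neighbours_def)
  then show ?thesis by simp
qed (simp add: card_neighbours[OF assms])

definition switch :: "nat \<Rightarrow> nat \<Rightarrow> nat \<Rightarrow> nat \<Rightarrow> edge set \<Rightarrow> edge set" where
  "switch u w x y E = E - {{u, w}, {x, y}} \<union> {{u, x}, {w, y}}"

lemma incident_switch_other:
  "v \<notin> {u, w, x, y} \<Longrightarrow> incident (switch u w x y E) v = incident E v"
  by (auto simp: incident_def switch_def)

lemma card_insert_Diff1:
  assumes "finite A" "e \<in> A" "f \<notin> A"
  shows "card (insert f (A - {e})) = card A"
  using assms card.remove[of A e] by simp

text \<open>Each of the four nodes loses one edge and gains one, and the gained edge was absent, so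
  all degrees survive. The remaining inequalities between the nodes are forced: \<open>x = w\<close>
  or \<open>y = u\<close> would make an absent pair equal to the edge \<open>{u, w}\<close>.\<close>

lemma switch_regular:
  assumes E: "E \<in> regular_graphs n d"
    and edges: "{u, w} \<in> E" "{x, y} \<in> E" "{u, x} \<notin> E" "{w, y} \<notin> E" "x \<noteq> u" "y \<noteq> w"
  shows "switch u w x y E \<in> regular_graphs n d"
proof -
  have in_n: "u \<in> {1..n}" "w \<in> {1..n}" "x \<in> {1..n}" "y \<in> {1..n}" "u \<noteq> w" "x \<noteq> y"
    using regular_graphs_edgeD[OF E edges(1)] regular_graphs_edgeD[OF E edges(2)] by auto
  have neq: "x \<noteq> w" "y \<noteq> u"
    using edges by (auto simp: insert_commute)
  have fin: "finite (incident E v)" for v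
    using finite_regular_graph[OF E] by (auto simp: incident_def)
  have "card (incident (switch u w x y E) v) = card (incident E v)" for v
  proof -
    consider "v = u" | "v = w" | "v = x" | "v = y" | "v \<notin> {u, w, x, y}" by auto
    then show ?thesis
    proof cases
      case 1
      have "incident (switch u w x y E) v = insert {u, x} (incident E v - {{u, w}})"
        using 1 neq edges in_n by (auto simp: incident_def switch_def doubleton_eq_iff)
      moreover have "{u, w} \<in> incident E v" "{u, x} \<notin> incident E v"
        using edges 1 by (simp_all add: incident_def)
      ultimately show ?thesis using card_insert_Diff1[OF fin] by simp
    next
      case 2
      have "incident (switch u w x y E) v = insert {w, y} (incident E v - {{u, w}})"
        using 2 neq edges in_n by (auto simp: incident_def switch_def doubleton_eq_iff)
      moreover have "{u, w} \<in> incident E v" "{w, y} \<notin> incident E v"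
        using edges 2 by (simp_all add: incident_def)
      ultimately show ?thesis using card_insert_Diff1[OF fin] by simp
    next
      case 3
      have "incident (switch u w x y E) v = insert {u, x} (incident E v - {{x, y}})"
        using 3 neq edges in_n by (auto simp: incident_def switch_def doubleton_eq_iff)
      moreover have "{x, y} \<in> incident E v" "{u, x} \<notin> incident E v"
        using edges 3 by (simp_all add: incident_def)
      ultimately show ?thesis using card_insert_Diff1[OF fin] by simp
    next
      case 4
      have "incident (switch u w x y E) v = insert {w, y} (incident E v - {{x, y}})"
        using 4 neq edges in_n by (auto simp: incident_def switch_def doubleton_eq_iff)
      moreover have "{x, y} \<in> incident E v" "{w, y} \<notin> incident E v"
        using edges 4 by (simp_all add: incident_def)
      ultimately show ?thesis using card_insert_Diff1[OF fin] by simp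
    qed (simp add: incident_switch_other)
  qed
  moreover have "switch u w x y E \<subseteq> {e. e \<subseteq> {1..n} \<and> card e = 2}"
    using E in_n edges(5,6) by (auto simp: switch_def regular_graphs_def)
  ultimately show ?thesis
    using E by (auto simp: regular_graphs_def)
qed

section \<open>Graphs consistent with a history\<close>

text \<open>Conditioned on the history, the random graph is uniform on this set, so conditional
  probabilities become ratios of cardinalities.\<close>

definition consistent :: "nat \<Rightarrow> nat \<Rightarrow> history \<Rightarrow> edge set set" where
  "consistent n d h = {E \<in> regular_graphs n d. \<forall>(v, a) \<in> set h. incident E v = a}"

definition known :: "history \<Rightarrow> edge set" where
  "known h = \<Union> (snd ` set h)"

lemma finite_consistent: "finite (consistent n d h)"
  using finite_regular_graphs by (rule finite_subset[rotated]) (auto simp: consistent_def)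

lemma consistent_regular: "E \<in> consistent n d h \<Longrightarrow> E \<in> regular_graphs n d"
  by (simp add: consistent_def)

text \<open>A query reveals everything about its node; hence an unknown edge of the graph has no
  queried endpoint.\<close>

lemma consistent_known_iff:
  assumes "E \<in> consistent n d h" "v \<in> fst ` set h" "v \<in> e"
  shows "e \<in> E \<longleftrightarrow> e \<in> known h"
  using assms by (force simp: consistent_def known_def incident_def)

lemma known_subset: "E \<in> consistent n d h \<Longrightarrow> known h \<subseteq> E"
  by (force simp: consistent_def known_def incident_def)

lemma consistent_Nil [simp]: "consistent n d [] = regular_graphs n d"
  by (simp add: consistent_def)

lemma known_Nil [simp]: "known [] = {}"
  by (simp add: known_def)

lemma known_snoc: "known (h @ [(v, a)]) = known h \<union> a"
  by (auto simp: known_def)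

lemma consistent_snoc:
  "consistent n d (h @ [(v, a)]) = {E \<in> consistent n d h. incident E v = a}"
  by (auto simp: consistent_def)

text \<open>There are \<open>d * n\<close> ordered adjacent pairs. A pair is bad if \<open>x\<close>
  lies in \<open>Q\<close>, equals \<open>u\<close> or is adjacent to \<open>u\<close>, or likewise
  for \<open>y\<close> and \<open>w\<close>. Each kind accounts for at most
  \<open>(k + (d + 1)) * d\<close> pairs, and the bound on \<open>n\<close> makes this at most half
  of all pairs in total.\<close>

lemma many_switchings:
  assumes E: "E \<in> regular_graphs n d"
    and Q: "finite Q" "card Q \<le> k" "u \<notin> Q" "w \<notin> Q"
    and n: "4 * k + 4 * (d + 1) \<le> n"
  shows "d * n \<le> 2 * card {(x, y). {x, y} \<in> E \<and> x \<notin> Q \<and> y \<notin> Q \<and> x \<noteq> u \<and> y \<noteq> w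
                            \<and> {u, x} \<notin> E \<and> {w, y} \<notin> E}"
    (is "_ \<le> 2 * card ?good")
proof -
  let ?N = "neighbours E"
  define B where "B z = Q \<union> insert z (?N z)" for z
  have finB: "finite (B z)" for z
    using Q finite_neighbours[OF E] by (simp add: B_def)
  have cardB: "card (B z) \<le> k + (d + 1)" for z
  proof -
    have "card (B z) \<le> card Q + card (insert z (?N z))"
      unfolding B_def by (rule card_Un_le)
    moreover have "card (insert z (?N z)) \<le> Suc (card (?N z))"
      by (rule card_insert_le_m1) simp_all
    ultimately show ?thesis using Q(2) card_neighbours_le[OF E, of z] by linarith
  qed
  have finS: "finite (Sigma (B z) ?N)" for z
    using finB finite_neighbours[OF E] by blast
  have cardS: "card (Sigma (B z) ?N) \<le> (k + (d + 1)) * d" for z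
  proof -
    have "card (Sigma (B z) ?N) = (\<Sum>a\<in>B z. card (?N a))"
      using finB finite_neighbours[OF E] by (intro card_SigmaI) auto
    also have "\<dots> \<le> card (B z) * d"
      using sum_bounded_above[of "B z" "\<lambda>a. card (?N a)" d] card_neighbours_le[OF E] by simp
    also have "\<dots> \<le> (k + (d + 1)) * d"
      using cardB by (rule mult_right_mono) simp
    finally show ?thesis .
  qed
  let ?all = "Sigma {1..n} ?N"
  have "card ?all = (\<Sum>a\<in>{1..n}. card (?N a))"
    using finite_neighbours[OF E] by (intro card_SigmaI) auto
  also have "\<dots> = n * d"
    using card_neighbours[OF E] by simp
  finally have all: "card ?all = n * d" .
  have finall: "finite ?all"
    using finite_neighbours[OF E] by blast
  have good: "?good \<subseteq> ?all"
    using regular_graphs_edgeD[OF E] by (auto simp: neighbours_def)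
  \<comment> \<open>Adjacency is symmetric, so pairs with a bad second node are swapped pairs with a
    bad first node.\<close>
  have "?all \<subseteq> ?good \<union> (Sigma (B u) ?N \<union> prod.swap ` Sigma (B w) ?N)"
    by (force simp: neighbours_def B_def insert_commute)
  then have "card ?all \<le> card (?good \<union> (Sigma (B u) ?N \<union> prod.swap ` Sigma (B w) ?N))"
    using finite_subset[OF good finall] finS by (intro card_mono) auto
  also have "\<dots> \<le> card ?good + (card (Sigma (B u) ?N) + card (prod.swap ` Sigma (B w) ?N))"
    by (meson card_Un_le add_left_mono order_trans)
  also have "\<dots> \<le> card ?good + ((k + (d + 1)) * d + (k + (d + 1)) * d)"
    using cardS card_image_le[OF finS, of prod.swap w]
    by (meson add_mono order_refl order_trans)
  finally have "n * d \<le> card ?good + 2 * ((k + (d + 1)) * d)"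
    using all by simp
  moreover have "4 * ((k + (d + 1)) * d) \<le> n * d"
    using mult_right_mono[OF n, of d] by (simp add: algebra_simps)
  ultimately show ?thesis by (simp add: mult.commute)
qed

text \<open>Double counting of switchings that stay consistent: each graph with the edge has at
  least \<open>d * n / 2\<close> of them, and each result comes with \<open>x\<close> adjacent to
  \<open>u\<close> and \<open>y\<close> adjacent to \<open>w\<close>, at most \<open>d * d\<close>
  choices. A common factor \<open>d\<close> cancels.\<close>

lemma card_consistent_edge:
  assumes unknown: "{u, w} \<notin> known h"
    and n: "4 * length h + 4 * (d + 1) \<le> n"
  shows "card {E \<in> consistent n d h. {u, w} \<in> E} * n \<le> 2 * d * card (consistent n d h)"
proof (cases "{E \<in> consistent n d h. {u, w} \<in> E} = {}")
  case False
  let ?C = "consistent n d h" and ?X = "{E \<in> consistent n d h. {u, w} \<in> E}"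
  define Q where "Q = fst ` set h"
  obtain E0 where E0: "E0 \<in> ?C" "{u, w} \<in> E0" using False by blast
  have uw: "u \<notin> Q" "w \<notin> Q"
    using consistent_known_iff[OF E0(1), of _ "{u, w}"] E0(2) unknown
    by (auto simp: Q_def)
  have "u \<in> {1..n}" "w \<in> neighbours E0 u"
    using regular_graphs_edgeD[OF consistent_regular[OF E0(1)] E0(2)] E0(2)
    by (auto simp: neighbours_def)
  \<comment> \<open>Positivity allows the cancellation of \<open>d\<close> at the end.\<close>
  then have d: "d > 0"
    using card_neighbours[OF consistent_regular[OF E0(1)], of u]
      finite_neighbours[OF consistent_regular[OF E0(1)], of u] by (auto simp: card_gt_0_iff)
  have finQ: "finite Q" and cardQ: "card Q \<le> length h"
    unfolding Q_def by (simp, metis card_image_le card_length finite_set order_trans)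
  let ?good = "\<lambda>E. {(x, y). {x, y} \<in> E \<and> x \<notin> Q \<and> y \<notin> Q \<and> x \<noteq> u \<and> y \<noteq> w
                            \<and> {u, x} \<notin> E \<and> {w, y} \<notin> E}"
  let ?f = "\<lambda>(E, x, y). (switch u w x y E, x, y)"
  let ?S = "Sigma ?X ?good" and ?T = "Sigma ?C (\<lambda>E. neighbours E u \<times> neighbours E w)"
  have finT: "finite ?T"
    using finite_consistent finite_neighbours consistent_regular by blast
  \<comment> \<open>The triple retains \<open>x\<close> and \<open>y\<close>, so the reverse
    switching recovers the original graph.\<close>
  have inj: "inj_on ?f ?S"
  proof (rule inj_on_inverseI)
    fix z assume "z \<in> ?S"
    then obtain E x y where z: "z = (E, x, y)" and E: "E \<in> ?X" and xy: "(x, y) \<in> ?good E" by blast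
    have "u \<noteq> w" using E regular_graphs_edgeD(3)[OF consistent_regular] by blast
    moreover have "x \<noteq> w" "y \<noteq> u" using E xy by (auto simp: insert_commute)
    ultimately have "E = switch u w x y E - {{u, x}, {w, y}} \<union> {{u, w}, {x, y}}"
      using E xy by (auto simp: switch_def doubleton_eq_iff)
    then show "(\<lambda>(E, x, y). (E - {{u, x}, {w, y}} \<union> {{u, w}, {x, y}}, x, y)) (?f z) = z"
      by (simp add: z)
  qed
  have sub: "?f ` ?S \<subseteq> ?T"
  proof (rule image_subsetI)
    fix z assume "z \<in> ?S"
    then obtain E x y where z: "z = (E, x, y)" and E: "E \<in> ?X" and xy: "(x, y) \<in> ?good E" by blast
    have "switch u w x y E \<in> regular_graphs n d"
      using E xy by (intro switch_regular) (auto dest: consistent_regular)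
    \<comment> \<open>None of the four switched nodes has been queried, so no recorded answer
      changes.\<close>
    moreover have "incident (switch u w x y E) v = a" if "(v, a) \<in> set h" for v a
    proof -
      have "v \<in> Q" using that by (force simp: Q_def)
      then have "v \<notin> {u, w, x, y}" using uw xy by auto
      then have "incident (switch u w x y E) v = incident E v" by (rule incident_switch_other)
      then show ?thesis using that E by (auto simp: consistent_def)
    qed
    ultimately have "switch u w x y E \<in> ?C" by (auto simp: consistent_def)
    then show "?f z \<in> ?T" by (auto simp: z switch_def neighbours_def)
  qed
  have fingood: "finite (?good E)" if "E \<in> ?X" for E
    by (rule finite_subset[of _ "{1..n} \<times> {1..n}"])
      (use that in \<open>auto dest!: consistent_regular dest: regular_graphs_edgeD\<close>)
  have "card ?X * (d * n) = (\<Sum>E\<in>?X. d * n)" by simp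
  also have "\<dots> \<le> (\<Sum>E\<in>?X. 2 * card (?good E))"
    by (intro sum_mono many_switchings[OF _ finQ cardQ uw n]) (auto dest: consistent_regular)
  also have "\<dots> = 2 * card ?S"
    using finite_consistent fingood by (subst card_SigmaI) (auto simp: sum_distrib_left)
  also have "card ?S \<le> card ?T"
    using inj sub finT by (rule card_inj_on_le)
  also have "card ?T = (\<Sum>E\<in>?C. card (neighbours E u \<times> neighbours E w))"
    using finite_consistent finite_neighbours consistent_regular by (intro card_SigmaI) blast+
  also have "\<dots> \<le> (\<Sum>E\<in>?C. d * d)"
    unfolding card_cartesian_product
    by (intro sum_mono mult_mono card_neighbours_le[OF consistent_regular]) auto
  finally have "d * (card ?X * n) \<le> d * (2 * d * card ?C)"
    by (simp add: algebra_simps)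
  then show ?thesis using d by simp
qed (simp only: card.empty mult_0)

text \<open>Each answer covers at most the queried node and its \<open>d\<close> neighbours.\<close>

lemma card_vertices_known:
  assumes "E \<in> consistent n d h"
  shows "finite (\<Union> (known h))" "card (\<Union> (known h)) \<le> (d + 1) * length h"
proof -
  have "\<Union> E \<subseteq> {1..n}"
    using assms by (auto simp: consistent_def regular_graphs_def)
  then have fin: "finite (\<Union> (known h'))" if "E \<in> consistent n d h'" for h'
    using known_subset[OF that] by (meson Union_mono finite_atLeastAtMost finite_subset)
  then show "finite (\<Union> (known h))" using assms by blast
  show "card (\<Union> (known h)) \<le> (d + 1) * length h"
    using assms
  proof (induction h rule: rev_induct)
    case (snoc va h)
    obtain v a where va: "va = (v, a)" by (cases va)
    have E: "E \<in> consistent n d h" and a: "incident E v = a"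
      using snoc.prems by (auto simp: va consistent_snoc)
    have "\<Union> a \<subseteq> insert v (neighbours E v)"
      using a incident_eq_image_neighbours[of E v] consistent_regular[OF E]
      by (auto simp: regular_graphs_def)
    then have "card (\<Union> a) \<le> card (insert v (neighbours E v))"
      using finite_neighbours[OF consistent_regular[OF E]] by (intro card_mono) auto
    also have "\<dots> \<le> Suc (card (neighbours E v))"
      by (rule card_insert_le_m1) simp_all
    also have "\<dots> \<le> d + 1"
      using card_neighbours_le[OF consistent_regular[OF E]] by simp
    finally have "card (\<Union> a) \<le> d + 1" .
    moreover have "card (\<Union> (known (h @ [va]))) \<le> card (\<Union> (known h)) + card (\<Union> a)"
      by (simp add: va known_snoc card_Un_le)
    ultimately show ?case using snoc.IH[OF E] by simp
  qed simp
qed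

section \<open>Separation of the endpoints\<close>

text \<open>A closed set \<open>S\<close> expresses that \<open>s\<close> and \<open>t\<close> lie
  in different components of \<open>F\<close>. Confining \<open>S\<close> to \<open>s\<close> and
  the nodes seen ensures that a new edge from the queried node into \<open>S\<close> counts as a
  collision.\<close>

definition separated :: "nat \<Rightarrow> nat \<Rightarrow> edge set \<Rightarrow> bool" where
  "separated s t F \<longleftrightarrow>
     (\<exists>S. S \<subseteq> insert s (\<Union> F) \<and> s \<in> S \<and> t \<notin> S \<and> (\<forall>a b. {a, b} \<in> F \<longrightarrow> a \<in> S \<longrightarrow> b \<in> S))"

lemma separated_empty: "s \<noteq> t \<Longrightarrow> separated s t {}"
  by (auto simp: separated_def)

text \<open>The pair is the first step of the path that leaves \<open>S\<close>. Since
  \<open>P\<close> is quantified after the pair, one pair serves all graphs at once.\<close>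

lemma crossing_pair:
  assumes "p \<noteq> []" "hd p \<in> S" "last p \<notin> S"
  shows "\<exists>u w. u \<in> S \<and> w \<notin> S \<and> (\<forall>P. successively P p \<longrightarrow> P u w)"
  using assms
proof (induction p rule: induct_list012)
  case (3 x y zs)
  show ?case
  proof (cases "y \<in> S")
    case True
    then obtain u w where "u \<in> S" "w \<notin> S" "\<forall>P. successively P (y # zs) \<longrightarrow> P u w"
      using 3 by auto
    then show ?thesis by (metis successively.simps(3))
  next
    case False
    then show ?thesis using 3 by auto
  qed
qed auto

text \<open>The crossing pair depends only on the path and the known edges, not on the graph.\<close>

lemma separated_path:
  assumes "separated s t F"
  shows "\<exists>u w. {u, w} \<notin> F \<and> (\<forall>E. valid_path E s t p \<longrightarrow> {u, w} \<in> E)"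
proof -
  obtain S where S: "s \<in> S" "t \<notin> S" "\<And>a b. {a, b} \<in> F \<Longrightarrow> a \<in> S \<Longrightarrow> b \<in> S"
    using assms unfolding separated_def by blast
  show ?thesis
  proof (cases "p \<noteq> [] \<and> hd p = s \<and> last p = t")
    case True
    then obtain u w where uw: "u \<in> S" "w \<notin> S" and cross: "\<forall>P. successively P p \<longrightarrow> P u w"
      using crossing_pair[of p S] S(1,2) by auto
    have "{u, w} \<in> E" if "valid_path E s t p" for E
      using cross[THEN spec, of "\<lambda>a b. {a, b} \<in> E"] that by (simp add: valid_path_def)
    then show ?thesis using S(3) uw by blast
  next
    \<comment> \<open>No graph makes such a list valid, so any pair outside \<open>F\<close> will
      do; \<open>{s, t}\<close> is one.\<close>
    case False
    then have "\<not> valid_path E s t p" for E by (auto simp: valid_path_def)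
    then show ?thesis using S by blast
  qed
qed

text \<open>The endpoints count as seen from the start, even before any known edge touches
  them.\<close>

definition collision :: "nat \<Rightarrow> nat \<Rightarrow> edge set \<Rightarrow> nat \<Rightarrow> edge set \<Rightarrow> bool" where
  "collision s t F v E \<longleftrightarrow> (\<exists>u \<in> {s, t} \<union> \<Union> F. {v, u} \<in> E - F)"

text \<open>Without a collision every new edge at \<open>v\<close> leads to an unseen node other
  than \<open>s\<close> and \<open>t\<close>. If \<open>v\<close> lies in \<open>S\<close>, adding
  its neighbours keeps the set closed; otherwise \<open>S\<close> itself still works.\<close>

lemma separated_extend:
  assumes "separated s t F" "\<not> collision s t F v E"
    and card2: "\<And>e. e \<in> E \<Longrightarrow> card e = 2"
  shows "separated s t (F \<union> incident E v)"
proof -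
  obtain S where S: "S \<subseteq> insert s (\<Union> F)" "s \<in> S" "t \<notin> S"
      "\<And>a b. {a, b} \<in> F \<Longrightarrow> a \<in> S \<Longrightarrow> b \<in> S"
    using assms unfolding separated_def by blast
  have fresh: "{v, u} \<in> F" if "{v, u} \<in> E" "u \<in> {s, t} \<union> \<Union> F" for u
    using assms(2) that unfolding collision_def by blast
  have sym: "a \<in> S" if "{a, b} \<in> F" "b \<in> S" for a b
    using S(4)[of b a] that by (simp add: insert_commute)
  define S' where "S' = S \<union> (if v \<in> S then neighbours E v else {})"
  have "S' \<subseteq> insert s (\<Union> (F \<union> incident E v))"
    using S(1) by (auto simp: S'_def neighbours_def incident_def)
  moreover have "s \<in> S'" using S(2) by (simp add: S'_def)
  moreover have "t \<notin> S'"
    using S(3,4) fresh[of t] by (auto simp: S'_def neighbours_def)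
  moreover have "b \<in> S'" if "{a, b} \<in> F \<union> incident E v" "a \<in> S'" for a b
  proof (cases "{a, b} \<in> F")
    case True
    have "a \<in> S"
    \<comment> \<open>A node \<open>a\<close> added to \<open>S\<close> would be a neighbour of
      \<open>v\<close>. As it lies on the known edge \<open>{a, b}\<close> it has been seen, so
      \<open>{v, a}\<close> is known and \<open>a\<close> was in \<open>S\<close> already.\<close>
    proof (rule ccontr)
      assume "a \<notin> S"
      then have "v \<in> S" "{v, a} \<in> E"
        using that(2) by (auto simp: S'_def neighbours_def split: if_splits)
      then show False using fresh[of a] True S(4) \<open>a \<notin> S\<close> by blast
    qed
    then show ?thesis using S(4) True by (simp add: S'_def)
  next
    case False
    then have ab: "{a, b} \<in> E" "v = a \<or> v = b" using that by (auto simp: incident_def)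
    show ?thesis
    proof (cases "v \<in> S")
      case True
      then show ?thesis using ab by (auto simp: S'_def neighbours_def)
    next
      \<comment> \<open>Here \<open>S'\<close> equals \<open>S\<close>, so the new edge joins
        \<open>v\<close> to a node of \<open>S\<close>. That node has been seen, so the edge is
        known and closure puts \<open>v\<close> into \<open>S\<close>, a contradiction.\<close>
      case vS: False
      then have "a \<in> S" "v = b" using that(2) ab by (auto simp: S'_def)
      moreover have "{v, a} \<in> F"
        using fresh[of a] ab S(1) \<open>a \<in> S\<close> \<open>v = b\<close> by (auto simp: insert_commute)
      ultimately show ?thesis using sym vS by blast
    qed
  qed
  ultimately show ?thesis unfolding separated_def by blast
qed

text \<open>A union bound over the seen nodes and the two endpoints, each unknown edge being
  controlled by \<open>card_consistent_edge\<close>.\<close>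

lemma card_collision:
  assumes n: "4 * length h + 4 * (d + 1) \<le> n"
  shows "card {E \<in> consistent n d h. collision s t (known h) v E} * n
         \<le> (2 + (d + 1) * length h) * (2 * d * card (consistent n d h))"
proof (cases "consistent n d h = {}")
  case False
  let ?C = "consistent n d h" and ?F = "known h"
  obtain E0 where E0: "E0 \<in> ?C" using False by blast
  define V where "V = {s, t} \<union> \<Union> ?F"
  \<comment> \<open>Nodes already joined to \<open>v\<close> by a known edge cannot cause a
    collision, and the edge bound applies to unknown edges only.\<close>
  define V' where "V' = {u \<in> V. {v, u} \<notin> ?F}"
  have finV: "finite V" using card_vertices_known[OF E0] by (simp add: V_def)
  then have finV': "finite V'" by (simp add: V'_def)
  have "card V \<le> card {s, t} + card (\<Union> ?F)"
    unfolding V_def by (rule card_Un_le)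
  also have "card {s, t} \<le> 2" by (simp add: card_insert_if)
  finally have "card V \<le> 2 + (d + 1) * length h"
    using card_vertices_known(2)[OF E0] by linarith
  moreover have "card V' \<le> card V"
    using finV by (intro card_mono) (auto simp: V'_def)
  ultimately have V': "card V' \<le> 2 + (d + 1) * length h" by linarith
  have "{E \<in> ?C. collision s t ?F v E} \<subseteq> (\<Union>u\<in>V'. {E \<in> ?C. {v, u} \<in> E})"
    unfolding collision_def V'_def V_def by blast
  then have "card {E \<in> ?C. collision s t ?F v E} \<le> card (\<Union>u\<in>V'. {E \<in> ?C. {v, u} \<in> E})"
    using finV' finite_consistent by (intro card_mono) auto
  also have "\<dots> \<le> (\<Sum>u\<in>V'. card {E \<in> ?C. {v, u} \<in> E})"
    using finV' by (rule card_UN_le)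
  finally have "card {E \<in> ?C. collision s t ?F v E} * n \<le> (\<Sum>u\<in>V'. card {E \<in> ?C. {v, u} \<in> E}) * n"
    by (rule mult_right_mono) simp
  also have "\<dots> = (\<Sum>u\<in>V'. card {E \<in> ?C. {v, u} \<in> E} * n)"
    by (rule sum_distrib_right)
  also have "\<dots> \<le> (\<Sum>u\<in>V'. 2 * d * card ?C)"
    by (intro sum_mono card_consistent_edge[OF _ n]) (simp add: V'_def)
  also have "\<dots> = card V' * (2 * d * card ?C)" by simp
  also have "\<dots> \<le> (2 + (d + 1) * length h) * (2 * d * card ?C)"
    using V' by (rule mult_right_mono) simp
  finally show ?thesis .
qed simp

section \<open>The success probability\<close>

text \<open>The graph is fixed here and only the algorithm is random; a run that never halts yields
  \<open>None\<close> and counts as a loss.\<close>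

definition win :: "algorithm \<Rightarrow> nat \<Rightarrow> nat \<Rightarrow> history \<Rightarrow> edge set \<Rightarrow> real" where
  "win A s t h E = measure_pmf.prob (run A E h) {Some p | p. valid_path E s t p}"

lemma measure_bind_pmf:
  "measure_pmf.prob (bind_pmf M N) X = measure_pmf.expectation M (\<lambda>x. measure_pmf.prob (N x) X)"
proof -
  have "ennreal (measure_pmf.prob (bind_pmf M N) X) = emeasure (measure_pmf (bind_pmf M N)) X"
    by (simp add: measure_pmf.emeasure_eq_measure)
  also have "\<dots> = (\<integral>\<^sup>+x. ennreal (measure_pmf.prob (N x) X) \<partial>measure_pmf M)"
    unfolding emeasure_bind_pmf by (simp add: measure_pmf.emeasure_eq_measure)
  also have "\<dots> = ennreal (measure_pmf.expectation M (\<lambda>x. measure_pmf.prob (N x) X))"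
    by (intro nn_integral_eq_integral measure_pmf.integrable_const_bound[where B = 1]) auto
  finally show ?thesis by (simp add: ennreal_inj integral_nonneg_AE)
qed

lemma win_bounds: "0 \<le> win A s t h E" "win A s t h E \<le> 1"
  by (simp_all add: win_def)

definition win_after :: "algorithm \<Rightarrow> nat \<Rightarrow> nat \<Rightarrow> history \<Rightarrow> edge set \<Rightarrow> action \<Rightarrow> real" where
  "win_after A s t h E a = (case a of
       Query v \<Rightarrow> win A s t (h @ [(v, incident E v)]) E
     | Output p \<Rightarrow> of_bool (valid_path E s t p))"

text \<open>The distribution \<open>A h\<close> does not depend on the graph. Sums over consistent
  graphs can therefore be bounded for each action separately and averaged afterwards.\<close>

lemma win_unfold: "win A s t h E = measure_pmf.expectation (A h) (win_after A s t h E)"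
proof -
  have "win A s t h E = measure_pmf.expectation (A h) (\<lambda>a. measure_pmf.prob
     (case a of Query v \<Rightarrow> run A E (h @ [(v, incident E v)]) | Output p \<Rightarrow> return_spmf p)
     {Some p | p. valid_path E s t p})"
    unfolding win_def by (subst run.simps) (simp only: bind_spmf_of_pmf measure_bind_pmf)
  also have "(\<lambda>a. measure_pmf.prob
     (case a of Query v \<Rightarrow> run A E (h @ [(v, incident E v)]) | Output p \<Rightarrow> return_spmf p)
     {Some p | p. valid_path E s t p}) = win_after A s t h E"
    by (auto simp: win_after_def win_def fun_eq_iff measure_return_pmf indicator_def
        split: action.split)
  finally show ?thesis .
qed

lemma win_after_bounds: "0 \<le> win_after A s t h E a" "win_after A s t h E a \<le> 1"
  using win_bounds by (auto simp: win_after_def split: action.split)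

lemma success_prob_eq:
  assumes "regular_graphs n d \<noteq> {}"
  shows "success_prob n d s t A =
    (\<Sum>E\<in>regular_graphs n d. win A s t [] E) / card (regular_graphs n d)"
proof -
  have "Pair E -` {(E, Some p) |E p. valid_path E s t p} = {Some p |p. valid_path E s t p}" for E
    by auto
  then show ?thesis
    by (simp add: success_prob_def measure_bind_pmf win_def
        integral_pmf_of_set[OF assms finite_regular_graphs])
qed

text \<open>Here \<open>b\<close> bounds the conditional probability of an unknown edge and
  \<open>q\<close> that of a collision at one query. Every remaining query costs at most
  \<open>q\<close>, with a collision conceded as a win, and the final output costs \<open>b\<close>.
  The induction is on the number of queries left.\<close>

lemma sum_win_le:
  fixes n d K s t :: nat
  defines "b \<equiv> 2 * real d / real n"
  defines "q \<equiv> b * (2 + (real d + 1) * real K)"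
  assumes n: "4 * K + 4 * (d + 1) \<le> n"
    and depth: "\<And>E h. E \<in> regular_graphs n d \<Longrightarrow> reachable A E h \<Longrightarrow> length h \<le> K"
    and "length h \<le> K" "separated s t (known h)" "\<And>E. E \<in> consistent n d h \<Longrightarrow> reachable A E h"
  shows "(\<Sum>E\<in>consistent n d h. win A s t h E)
         \<le> card (consistent n d h) * (b + (real K - real (length h)) * q)"
  using assms(5-)
proof (induction "K - length h" arbitrary: h rule: less_induct)
  case less
  let ?C = "consistent n d h"
  define B where "B = b + (real K - real (length h)) * q"
  define B' where "B' = b + (real K - real (Suc (length h))) * q"
  have npos: "real n > 0" using n by simp
  have b0: "b \<ge> 0" by (simp add: b_def)
  then have q0: "q \<ge> 0" by (simp add: q_def)
  have nh: "4 * length h + 4 * (d + 1) \<le> n" using n less.prems(1) by simp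
  have integrable: "integrable (measure_pmf (A h)) (win_after A s t h E)" for E
    by (intro measure_pmf.integrable_const_bound[where B = 1]) (simp_all add: win_after_bounds)
  have "(\<Sum>E\<in>?C. win_after A s t h E a) \<le> card ?C * B" if a: "a \<in> set_pmf (A h)" for a
  proof (cases a)
    case (Output p)
    \<comment> \<open>The pair depends on \<open>h\<close> and \<open>p\<close> only, so a single
      unknown edge accounts for all graphs on which \<open>p\<close> is valid.\<close>
    obtain u w where uw: "{u, w} \<notin> known h" "\<And>E. valid_path E s t p \<Longrightarrow> {u, w} \<in> E"
      using separated_path[OF less.prems(2), of p] by blast
    have "(\<Sum>E\<in>?C. win_after A s t h E a) \<le> (\<Sum>E\<in>?C. of_bool ({u, w} \<in> E))"
      using uw(2) by (intro sum_mono) (auto simp: win_after_def Output)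
    also have "\<dots> = card {E \<in> ?C. {u, w} \<in> E}"
      using finite_consistent by (simp add: Int_def)
    also have "\<dots> \<le> card ?C * b"
      using card_consistent_edge[OF uw(1) nh, THEN of_nat_mono[where 'a = real]] npos
      by (simp add: b_def field_simps)
    also have "\<dots> \<le> card ?C * B"
      using less.prems(1) q0 by (intro mult_left_mono) (simp_all add: B_def)
    finally show ?thesis .
  next
    case (Query v)
    show ?thesis
    proof (cases "?C = {}")
      case False
      let ?col = "collision s t (known h) v"
      have reach: "reachable A E (h @ [(v, incident E v)])" if "E \<in> ?C" for E
        using less.prems(3)[OF that] a by (auto simp: Query intro: reachable.query)
      from False obtain E0 where "E0 \<in> ?C" by blast
      \<comment> \<open>The extended history is itself reachable, so the depth bound applies to it;
        this gives \<open>B' \<ge> 0\<close> below.\<close>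
      then have len: "Suc (length h) \<le> K"
        using depth[OF consistent_regular reach] by fastforce
      \<comment> \<open>Graphs are grouped by the answer \<open>x\<close>. Either all graphs of a
        group collide, and the trivial bound 1 suffices, or one does not; then separation persists
        for the whole group, since the known edges depend only on \<open>h\<close> and
        \<open>x\<close>.\<close>
      have part: "(\<Sum>E\<in>{E \<in> ?C. incident E v = x}. win A s t (h @ [(v, incident E v)]) E)
          \<le> (\<Sum>E\<in>{E \<in> ?C. incident E v = x}. B' + of_bool (?col E))" for x
      proof (cases "\<forall>E\<in>?C. incident E v = x \<longrightarrow> ?col E")
        case True
        have "B' \<ge> 0" using len q0 b0 by (simp add: B'_def)
        then show ?thesis
          using True by (intro sum_mono order_trans[OF win_bounds(2)]) auto
      next
        case False
        then obtain E1 where E1: "E1 \<in> ?C" "incident E1 v = x" "\<not> ?col E1" by blast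
        let ?h = "h @ [(v, x)]"
        have "separated s t (known h \<union> incident E1 v)"
          using consistent_regular[OF E1(1)]
          by (intro separated_extend[OF less.prems(2) E1(3)]) (auto simp: regular_graphs_def)
        then have sep: "separated s t (known ?h)" by (simp add: known_snoc E1(2))
        have "(\<Sum>E\<in>{E \<in> ?C. incident E v = x}. win A s t (h @ [(v, incident E v)]) E)
            = (\<Sum>E\<in>consistent n d ?h. win A s t ?h E)"
          unfolding consistent_snoc by (rule sum.cong) auto
        also have "\<dots> \<le> card (consistent n d ?h) * (b + (real K - real (length ?h)) * q)"
        proof (rule less.hyps)
          show "K - length ?h < K - length h" "length ?h \<le> K" using len by simp_all
          show "reachable A E ?h" if "E \<in> consistent n d ?h" for E
            using reach that by (auto simp: consistent_snoc)
        qed (rule sep)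
        also have "\<dots> = (\<Sum>E\<in>consistent n d ?h. B')" by (simp add: B'_def)
        also have "\<dots> \<le> (\<Sum>E\<in>consistent n d ?h. B' + of_bool (?col E))"
          by (intro sum_mono) simp
        finally show ?thesis by (simp add: consistent_snoc)
      qed
      have "(\<Sum>E\<in>?C. win_after A s t h E a) = (\<Sum>E\<in>?C. win A s t (h @ [(v, incident E v)]) E)"
        by (simp add: win_after_def Query)
      also have "\<dots> = (\<Sum>x\<in>(\<lambda>E. incident E v) ` ?C. \<Sum>E\<in>{E \<in> ?C. incident E v = x}.
          win A s t (h @ [(v, incident E v)]) E)"
        by (rule sum.image_gen[OF finite_consistent])
      also have "\<dots> \<le> (\<Sum>x\<in>(\<lambda>E. incident E v) ` ?C. \<Sum>E\<in>{E \<in> ?C. incident E v = x}.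
          B' + of_bool (?col E))"
        by (intro sum_mono part)
      also have "\<dots> = (\<Sum>E\<in>?C. B' + of_bool (?col E))"
        by (rule sum.image_gen[OF finite_consistent, symmetric])
      also have "\<dots> = card ?C * B' + card {E \<in> ?C. ?col E}"
        using finite_consistent by (simp add: sum.distrib Int_def)
      also have "card {E \<in> ?C. ?col E} \<le> card ?C * q"
      proof -
        have "real (card {E \<in> ?C. ?col E}) * n \<le> (2 + (real d + 1) * length h) * (2 * d * card ?C)"
          using card_collision[OF nh, THEN of_nat_mono[where 'a = real], of s t v]
          by (simp add: algebra_simps)
        also have "\<dots> \<le> (2 + (real d + 1) * K) * (2 * d * card ?C)"
          using less.prems(1) by (intro mult_right_mono add_left_mono mult_left_mono) auto
        finally show ?thesis using npos by (simp add: q_def b_def field_simps)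
      qed
      also have "card ?C * B' + card ?C * q = card ?C * B"
        by (simp add: B_def B'_def algebra_simps)
      finally show ?thesis by simp
    qed simp
  qed
  then have "measure_pmf.expectation (A h) (\<lambda>a. \<Sum>E\<in>?C. win_after A s t h E a) \<le> card ?C * B"
    using integrable by (intro measure_pmf.integral_le_const) (auto simp: AE_measure_pmf_iff)
  then show ?case
    using integrable by (simp add: win_unfold B_def)
qed

section \<open>Existence of regular graphs\<close>

text \<open>A connection set for a circulant graph, closed under negation modulo \<open>n\<close>.
  The smallest and largest \<open>d div 2\<close> residues are taken; for odd \<open>d\<close> the
  number \<open>n\<close> is even, and the self-inverse residue \<open>n / 2\<close> is
  added.\<close>

lemma symmetric_differences:
  assumes "d < n" "even (d * n)"
  obtains S :: "nat set" where "S \<subseteq> {1..<n}" "card S = d" "\<And>s. s \<in> S \<Longrightarrow> n - s \<in> S"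
proof -
  define m where "m = d div 2"
  define T where "T = {1..m} \<union> {n - m..<n}"
  have m: "2 * m \<le> d" by (simp add: m_def)
  then have T: "T \<subseteq> {1..<n}" "\<And>s. s \<in> T \<Longrightarrow> n - s \<in> T"
    using assms(1) by (auto simp: T_def)
  have "{1..m} \<inter> {n - m..<n} = {}" using m assms(1) by auto
  then have cardT: "card T = 2 * m"
    using m assms(1) by (simp add: T_def card_Un_disjoint)
  show thesis
  proof (cases "even d")
    case True
    then show ?thesis using T cardT by (intro that[of T]) (auto simp: m_def)
  next
    case False
    then have d: "d = 2 * m + 1" by (simp add: m_def)
    obtain k where k: "n = 2 * k" using assms(2) False by auto
    then have "k \<notin> T" "k \<in> {1..<n}" using d assms(1) by (auto simp: T_def)
    then show ?thesis
      using T cardT d k finite_subset[OF T(1)] by (intro that[of "insert k T"]) auto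
  qed
qed

text \<open>The witness is a circulant graph.\<close>

lemma regular_graphs_nonempty:
  assumes "d < n" "even (d * n)"
  shows "regular_graphs n d \<noteq> {}"
proof -
  obtain S where S: "S \<subseteq> {1..<n}" "card S = d" "\<And>s. s \<in> S \<Longrightarrow> n - s \<in> S"
    using symmetric_differences[OF assms] by blast
  \<comment> \<open>This is congruence of \<open>y\<close> and \<open>x + s\<close> modulo
    \<open>n\<close> with representatives in \<open>{1..n}\<close>; since \<open>s < n\<close>, at
    most one wrap-around occurs.\<close>
  define adj where "adj x y \<longleftrightarrow> x \<in> {1..n} \<and> y \<in> {1..n} \<and> (\<exists>s\<in>S. y = x + s \<or> y + n = x + s)"
    for x y
  have sym: "adj y x" if adj: "adj x y" for x y
  proof -
    obtain s where s: "s \<in> S" "y = x + s \<or> y + n = x + s" and xy: "x \<in> {1..n}" "y \<in> {1..n}"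
      using adj unfolding adj_def by blast
    then have "x = y + (n - s) \<or> x + n = y + (n - s)" using S(1) by auto
    then show ?thesis using S(3)[OF s(1)] xy by (auto simp: adj_def)
  qed
  have irrefl: "\<not> adj x x" for x using S(1) by (auto simp: adj_def)
  define E where "E = {{x, y} | x y. adj x y}"
  have E: "{x, y} \<in> E \<longleftrightarrow> adj x y" for x y
    using sym by (auto simp: E_def doubleton_eq_iff)
  have card2: "e \<subseteq> {1..n} \<and> card e = 2" if e: "e \<in> E" for e
  proof -
    obtain x y where xy: "e = {x, y}" "adj x y" using e by (auto simp: E_def)
    then have "x \<noteq> y" using irrefl by blast
    then show ?thesis using xy by (simp add: adj_def)
  qed
  have "card (incident E v) = d" if v: "v \<in> {1..n}" for v
  proof -
    let ?f = "\<lambda>s. if v + s \<le> n then v + s else v + s - n"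
    have "neighbours E v = ?f ` S"
    proof (intro equalityI subsetI)
      fix y assume "y \<in> neighbours E v"
      then obtain s where s: "s \<in> S" "y = v + s \<or> y + n = v + s" "y \<in> {1..n}"
        by (auto simp: neighbours_def E adj_def)
      then have "y = ?f s" by auto
      then show "y \<in> ?f ` S" using s(1) by blast
    next
      fix y assume "y \<in> ?f ` S"
      then obtain s where s: "s \<in> S" "y = ?f s" by blast
      then have "y \<in> {1..n} \<and> (y = v + s \<or> y + n = v + s)" using v S(1) by auto
      then show "y \<in> neighbours E v"
        using s(1) v by (auto simp: neighbours_def E adj_def)
    qed
    moreover have "inj_on ?f S"
    proof (rule inj_onI)
      fix s s' assume "s \<in> S" "s' \<in> S" and eq: "?f s = ?f s'"
      then have "s < n" "s' < n" using S(1) by auto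
      then show "s = s'" using eq by (auto split: if_splits)
    qed
    ultimately have "card (neighbours E v) = d"
      using S(2) by (simp only: card_image)
    then show ?thesis using card_incident[of E v] card2 by simp
  qed
  then have "E \<in> regular_graphs n d"
    using card2 by (auto simp: regular_graphs_def)
  then show ?thesis by blast
qed

section \<open>Choice of constants and the asymptotic bound\<close>

text \<open>The constant \<open>c\<close> may depend on \<open>\<epsilon>\<close> and
  \<open>D\<close>, while the threshold for \<open>n\<close> is uniform in \<open>d\<close> and
  \<open>A\<close>. Thus algorithms whose query counts are of smaller order than
  \<open>sqrt n\<close> have success probability tending to 0.\<close>

theorem theorem5:
  fixes D :: nat and \<epsilon> :: real
  assumes "\<epsilon> > 0"
  shows "\<exists>c>0. \<forall>\<^sub>F n in sequentially. \<forall>d\<le>D. even (d * n) \<longrightarrow>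
           (\<forall>A :: algorithm.
              makes_at_least_queries n d A (c * sqrt (real n))
              \<or> success_prob n d 1 n A \<le> \<epsilon>)"
proof -
  \<comment> \<open>Chosen so that the term quadratic in the number of queries contributes at most
    \<open>\<epsilon> / 2\<close>.\<close>
  define c where "c = sqrt \<epsilon> / (2 * (real D + 1))"
  have c: "c > 0" using assms by (simp add: c_def)
  have c2: "2 * (real D + 1)\<^sup>2 * c\<^sup>2 = \<epsilon> / 2"
  proof -
    have "c\<^sup>2 = \<epsilon> / (4 * (real D + 1)\<^sup>2)"
      using assms by (simp add: c_def power_divide power_mult_distrib del: distrib_left_numeral)
    then show ?thesis by simp
  qed
  \<comment> \<open>Once \<open>sqrt n\<close> is at least \<open>r\<close>, the lower-order terms
    contribute at most the other \<open>\<epsilon> / 2\<close>.\<close>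
  define r where "r = 4 * real D * (1 + 2 * c) / \<epsilon>"
  have r: "r \<ge> 0" using assms c by (simp add: r_def)
  define M where "M = 1 + 4 * c + 4 * (real D + 1) + r"
  have "\<forall>\<^sub>F n in sequentially. M \<le> sqrt (real n)"
    using filterlim_compose[OF sqrt_at_top filterlim_real_sequentially]
    by (simp add: filterlim_at_top)
  then have "\<forall>\<^sub>F n in sequentially. \<forall>d\<le>D. even (d * n) \<longrightarrow>
           (\<forall>A. makes_at_least_queries n d A (c * sqrt (real n)) \<or> success_prob n d 1 n A \<le> \<epsilon>)"
  proof eventually_elim
    case (elim n)
    define x where "x = sqrt (real n)"
    have xx: "x * x = real n" by (simp add: x_def)
    have M: "1 + 4 * c + 4 * (real D + 1) + r \<le> x"
      using elim by (simp add: M_def x_def)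
    have x1: "1 \<le> x" using M r c by (simp add: algebra_simps)
    have xM: "4 * c + 4 * (real D + 1) \<le> x" using M r by linarith
    have x\<epsilon>: "r \<le> x" using M c by (simp add: algebra_simps)
    have n_ge: "4 * (c * x) + 4 * (real D + 1) \<le> real n"
    proof -
      have "4 * (c * x) + 4 * (real D + 1) * 1 \<le> 4 * (c * x) + 4 * (real D + 1) * x"
        using x1 by (intro add_left_mono mult_left_mono) auto
      also have "\<dots> = (4 * c + 4 * (real D + 1)) * x" by (simp add: algebra_simps)
      also have "\<dots> \<le> x * x" using xM x1 by (intro mult_right_mono) auto
      finally show ?thesis by (simp add: xx)
    qed
    show ?case
    proof (intro allI impI)
      fix d A assume d: "d \<le> D" and even: "even (d * n)"
      show "makes_at_least_queries n d A (c * sqrt (real n)) \<or> success_prob n d 1 n A \<le> \<epsilon>"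
      proof (cases "makes_at_least_queries n d A (c * sqrt (real n))")
        case False
        \<comment> \<open>Histories are shorter than \<open>c * x\<close>, and lengths are integers,
          so rounding down loses nothing.\<close>
        define K where "K = nat \<lfloor>c * x\<rfloor>"
        have cx: "c * x \<ge> 0" using c x1 by simp
        then have K: "real K \<le> c * x" by (simp add: K_def)
        have "real (4 * K + 4 * (d + 1)) \<le> real n"
          using n_ge K d by simp
        then have nK: "4 * K + 4 * (d + 1) \<le> n" by (simp only: of_nat_le_iff)
        let ?R = "regular_graphs n d"
        \<comment> \<open>Nonemptiness makes the uniform distribution meaningful;
          \<open>d < n\<close> follows from \<open>nK\<close>.\<close>
        have R: "?R \<noteq> {}" using nK even by (intro regular_graphs_nonempty) auto
        then have cardR: "card ?R > 0" using finite_regular_graphs by (simp add: card_gt_0_iff)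
        have depth: "length h \<le> K" if "E \<in> ?R" "reachable A E h" for E h
        proof -
          have "real (length h) < c * x"
            using False that by (force simp: makes_at_least_queries_def x_def)
          then show ?thesis unfolding K_def by (simp add: le_nat_floor)
        qed
        let ?b = "2 * real d / real n"
        have "(\<Sum>E\<in>?R. win A 1 n [] E)
            \<le> card ?R * (?b + real K * (?b * (2 + (real d + 1) * real K)))"
          using sum_win_le[OF nK depth, where h = "[]" and s = 1 and t = n] nK
          by (simp add: separated_empty reachable.start)
        then have "success_prob n d 1 n A \<le> ?b + real K * (?b * (2 + (real d + 1) * real K))"
          unfolding success_prob_eq[OF R] using cardR by (simp add: divide_le_eq mult.commute)
        also have "\<dots> = ?b * (1 + 2 * real K + (real d + 1) * (real K)\<^sup>2)"
          by (simp add: algebra_simps add_divide_distrib power2_eq_square)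
        also have "\<dots> \<le> (2 * real D / real n) * (1 + 2 * (c * x) + (real D + 1) * (c * x)\<^sup>2)"
          using d K cx by (intro mult_mono add_mono divide_right_mono power_mono) auto
        also have "\<dots> = (2 * real D + 4 * real D * (c * x)) / (x * x) + 2 * real D * (real D + 1) * c\<^sup>2"
          using x1 by (simp add: xx[symmetric] field_simps power2_eq_square)
        also have "\<dots> \<le> \<epsilon> / 2 + \<epsilon> / 2"
        proof (rule add_mono)
          have "2 * real D + 4 * real D * (c * x) \<le> 2 * real D * x + 4 * real D * (c * x)"
            using x1 by (simp add: mult_le_cancel_left1)
          also have "\<dots> = (2 * real D * (1 + 2 * c)) * x" by (simp add: algebra_simps)
          also have "\<dots> \<le> (\<epsilon> / 2 * x) * x"
            using x\<epsilon> x1 assms by (intro mult_right_mono) (simp_all add: r_def field_simps)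
          finally show "(2 * real D + 4 * real D * (c * x)) / (x * x) \<le> \<epsilon> / 2"
            using x1 by (simp add: divide_le_eq mult.assoc)
          have "2 * real D * (real D + 1) * c\<^sup>2 \<le> 2 * (real D + 1)\<^sup>2 * c\<^sup>2"
            by (intro mult_right_mono) (simp_all add: power2_eq_square algebra_simps)
          then show "2 * real D * (real D + 1) * c\<^sup>2 \<le> \<epsilon> / 2" by (simp add: c2)
        qed
        finally show ?thesis by simp
      qed simp
    qed
  qed
  then show ?thesis using c by blast
qed

end
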